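(* Let $R$ be an abelian ring. Then $R$ is VNL if and only if $R/M(R)$ is a local ring.
   Context: Rings are associative with identity. A ring is abelian if all its idempotents are central. An element $a$ of a ring $R$ is (von Neumann) regular if $a=aba$ for some $b\in R$. A ring $R$ is VNL if for each $a\in R$, either $a$ or $1-a$ is regular in $R$. $M(R)$ denotes the maximal regular ideal of $R$ in the sense of Brown and McCoy, i.e. the largest two-sided ideal of $R$ all of whose elements are regular. A ring is local if it has a unique maximal right ideal.
   Formalization: The condition "R/M(R) is a local ring" is replaced by "R/M(R) is a local ring or the zero ring", since for a regular ring R (e.g. a field) R is VNL but R/M(R) = 0 has no maximal right ideal and so is not local. *)

theory Defs
  imports "HOL-Algebra.Algebra"
begin

definition idempotent_elt :: "('a, 'b) ring_scheme \<Rightarrow> 'a \<Rightarrow> bool" where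
  "idempotent_elt R e \<longleftrightarrow> e \<in> carrier R \<and> e \<otimes>\<^bsub>R\<^esub> e = e"

definition central_elt :: "('a, 'b) ring_scheme \<Rightarrow> 'a \<Rightarrow> bool" where
  "central_elt R c \<longleftrightarrow> c \<in> carrier R \<and> (\<forall>x\<in>carrier R. c \<otimes>\<^bsub>R\<^esub> x = x \<otimes>\<^bsub>R\<^esub> c)"

text \<open>``Abelian'' refers to idempotents, not to commutativity of addition (as in the
  library's \<open>abelian_group\<close>) or of multiplication.\<close>

definition abelian_ring :: "('a, 'b) ring_scheme \<Rightarrow> bool" where
  "abelian_ring R \<longleftrightarrow> ring R \<and> (\<forall>e. idempotent_elt R e \<longrightarrow> central_elt R e)"

definition regular_elt :: "('a, 'b) ring_scheme \<Rightarrow> 'a \<Rightarrow> bool" where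
  "regular_elt R a \<longleftrightarrow>
     a \<in> carrier R \<and> (\<exists>b\<in>carrier R. a = a \<otimes>\<^bsub>R\<^esub> b \<otimes>\<^bsub>R\<^esub> a)"

definition VNL_ring :: "('a, 'b) ring_scheme \<Rightarrow> bool" where
  "VNL_ring R \<longleftrightarrow>
     ring R \<and> (\<forall>a\<in>carrier R. regular_elt R a \<or> regular_elt R (\<one>\<^bsub>R\<^esub> \<ominus>\<^bsub>R\<^esub> a))"

definition regular_ideal :: "('a, 'b) ring_scheme \<Rightarrow> 'a set \<Rightarrow> bool" where
  "regular_ideal R I \<longleftrightarrow> ideal I R \<and> (\<forall>a\<in>I. regular_elt R a)"

text \<open>Since the order on sets is inclusion, \<open>GREATEST\<close> denotes the regular two-sided
  ideal that contains every regular two-sided ideal; by Brown and McCoy it exists in every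
  ring. It need not be proper: it is the whole ring iff the ring is regular.\<close>

definition max_regular_ideal :: "('a, 'b) ring_scheme \<Rightarrow> 'a set" where
  "max_regular_ideal R = (GREATEST I. regular_ideal R I)"

definition right_ideal :: "'a set \<Rightarrow> ('a, 'b) ring_scheme \<Rightarrow> bool" where
  "right_ideal I R \<longleftrightarrow>
     ring R \<and> additive_subgroup I R \<and> (\<forall>x\<in>I. \<forall>r\<in>carrier R. x \<otimes>\<^bsub>R\<^esub> r \<in> I)"

definition maximal_right_ideal :: "'a set \<Rightarrow> ('a, 'b) ring_scheme \<Rightarrow> bool" where
  "maximal_right_ideal I R \<longleftrightarrow>
     right_ideal I R \<and> I \<noteq> carrier R \<and>
     (\<forall>J. right_ideal J R \<longrightarrow> I \<subseteq> J \<longrightarrow> J = I \<or> J = carrier R)"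

text \<open>The zero ring has no maximal right ideal, hence is not local in this sense.
  The quotient of \<open>R\<close> by \<open>max_regular_ideal R\<close> is zero iff \<open>R\<close> is regular; such an \<open>R\<close> (say, a
  field) is trivially VNL, so the theorem lists this degenerate quotient separately.\<close>

definition local_ring :: "('a, 'b) ring_scheme \<Rightarrow> bool" where
  "local_ring R \<longleftrightarrow> ring R \<and> (\<exists>!I. maximal_right_ideal I R)"

definition zero_ring :: "('a, 'b) ring_scheme \<Rightarrow> bool" where
  "zero_ring R \<longleftrightarrow> ring R \<and> carrier R = {\<zero>\<^bsub>R\<^esub>}"

end

theory Submission
  imports Defs
begin

text \<open>An element \<open>a\<close> is regular as soon as \<open>a - aba\<close> is regular for some \<open>b\<close>. Hence sums of
  regular ideals are regular, the largest regular ideal \<open>M\<close> exists, and regularity lifts modulo \<open>M\<close>.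
  If \<open>R/M\<close> is local then each \<open>a\<close> or \<open>1 - a\<close> is right invertible modulo \<open>M\<close>, so it is regular.
  Conversely, if \<open>e\<close> is a central idempotent of a VNL ring and \<open>ex\<close>, \<open>(1 - e)y\<close> are both not
  regular, then \<open>a = ex + (1 - e)(1 - y)\<close> contradicts VNL; so \<open>eR\<close> or \<open>(1 - e)R\<close> is a regular ideal.
  For \<open>a = aba\<close> apply this to \<open>e = ab\<close>: either \<open>a\<close> vanishes modulo \<open>M\<close>, or \<open>ab\<close> is \<open>1\<close>
  modulo \<open>M\<close>.\<close>

section \<open>Local rings\<close>

lemma (in ring) additive_subgroupI':
  assumes "H \<subseteq> carrier R" "\<zero> \<in> H"
    and "\<And>x y. \<lbrakk>x \<in> H; y \<in> H\<rbrakk> \<Longrightarrow> x \<oplus> y \<in> H"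
    and "\<And>x. x \<in> H \<Longrightarrow> \<ominus> x \<in> H"
  shows "additive_subgroup H R"
  using assms
  by (intro additive_subgroupI add.subgroupI) (auto simp: a_inv_def)

lemma (in ring) ideal_memI:
  assumes "H \<subseteq> carrier R" "\<zero> \<in> H"
    and "\<And>x y. \<lbrakk>x \<in> H; y \<in> H\<rbrakk> \<Longrightarrow> x \<oplus> y \<in> H"
    and "\<And>x. x \<in> H \<Longrightarrow> \<ominus> x \<in> H"
    and "\<And>x r. \<lbrakk>x \<in> H; r \<in> carrier R\<rbrakk> \<Longrightarrow> r \<otimes> x \<in> H"
    and "\<And>x r. \<lbrakk>x \<in> H; r \<in> carrier R\<rbrakk> \<Longrightarrow> x \<otimes> r \<in> H"
  shows "ideal H R"
  using assms
  by (intro idealI ring_axioms additive_subgroup.a_subgroup additive_subgroupI') auto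

lemma (in ring) right_idealI:
  assumes "H \<subseteq> carrier R" "\<zero> \<in> H"
    and "\<And>x y. \<lbrakk>x \<in> H; y \<in> H\<rbrakk> \<Longrightarrow> x \<oplus> y \<in> H"
    and "\<And>x. x \<in> H \<Longrightarrow> \<ominus> x \<in> H"
    and "\<And>x r. \<lbrakk>x \<in> H; r \<in> carrier R\<rbrakk> \<Longrightarrow> x \<otimes> r \<in> H"
  shows "right_ideal H R"
  unfolding right_ideal_def using assms ring_axioms additive_subgroupI' by auto

lemma right_idealD:
  assumes "right_ideal H R"
  shows "H \<subseteq> carrier R" "\<zero>\<^bsub>R\<^esub> \<in> H"
    and "\<And>x y. \<lbrakk>x \<in> H; y \<in> H\<rbrakk> \<Longrightarrow> x \<oplus>\<^bsub>R\<^esub> y \<in> H"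
    and "\<And>x. x \<in> H \<Longrightarrow> \<ominus>\<^bsub>R\<^esub> x \<in> H"
    and "\<And>x r. \<lbrakk>x \<in> H; r \<in> carrier R\<rbrakk> \<Longrightarrow> x \<otimes>\<^bsub>R\<^esub> r \<in> H"
proof -
  interpret ring R using assms by (simp add: right_ideal_def)
  interpret additive_subgroup H R using assms by (simp add: right_ideal_def)
  show "H \<subseteq> carrier R" "\<zero>\<^bsub>R\<^esub> \<in> H" by auto
  show "\<And>x y. \<lbrakk>x \<in> H; y \<in> H\<rbrakk> \<Longrightarrow> x \<oplus>\<^bsub>R\<^esub> y \<in> H" by auto
  show "\<And>x. x \<in> H \<Longrightarrow> \<ominus>\<^bsub>R\<^esub> x \<in> H" by auto
  show "\<And>x r. \<lbrakk>x \<in> H; r \<in> carrier R\<rbrakk> \<Longrightarrow> x \<otimes>\<^bsub>R\<^esub> r \<in> H"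
    using assms by (simp add: right_ideal_def)
qed

lemma (in ring) right_ideal_eq_carrier:
  assumes "right_ideal H R" "\<one> \<in> H"
  shows "H = carrier R"
  using right_idealD(1,5)[OF assms(1)] assms(2) by (metis l_one subsetI subset_antisym)

section \<open>Existence of maximal right ideals\<close>

lemma (in ring) right_ideal_Union_chain:
  assumes "C \<noteq> {}" and ideal: "\<And>I. I \<in> C \<Longrightarrow> right_ideal I R"
    and chain: "\<And>I J. \<lbrakk>I \<in> C; J \<in> C\<rbrakk> \<Longrightarrow> I \<subseteq> J \<or> J \<subseteq> I"
  shows "right_ideal (\<Union>C) R"
proof (rule right_idealI)
  show "\<Union>C \<subseteq> carrier R" using right_idealD(1)[OF ideal] by blast
  show "\<zero> \<in> \<Union>C" using assms(1) right_idealD(2)[OF ideal] by blast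
  show "x \<oplus> y \<in> \<Union>C" if xy: "x \<in> \<Union>C" "y \<in> \<Union>C" for x y
  proof -
    from xy obtain I J where IJ: "I \<in> C" "x \<in> I" "J \<in> C" "y \<in> J" by auto
    then obtain K where "K \<in> C" "x \<in> K" "y \<in> K"
      using chain[OF IJ(1,3)] by auto
    then show ?thesis using right_idealD(3)[OF ideal] by auto
  qed
  show "\<ominus> x \<in> \<Union>C" if "x \<in> \<Union>C" for x
    using that right_idealD(4)[OF ideal] by auto
  show "x \<otimes> r \<in> \<Union>C" if "x \<in> \<Union>C" "r \<in> carrier R" for x r
    using that right_idealD(5)[OF ideal] by auto
qed

text \<open>Zorn's lemma applied to the right ideals above \<open>I\<close>.\<close>

lemma (in ring) ex_maximal_right_ideal:
  assumes "right_ideal I R" "I \<noteq> carrier R"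
  obtains J where "maximal_right_ideal J R" "I \<subseteq> J"
proof -
  \<comment> \<open>Properness is encoded as omitting \<open>\<one>\<close>, a condition that
    clearly survives unions of chains.\<close>
  define A where "A = {J. right_ideal J R \<and> I \<subseteq> J \<and> \<one> \<notin> J}"
  have "\<exists>M\<in>A. \<forall>K\<in>A. M \<subseteq> K \<longrightarrow> K = M"
  proof (rule subset_Zorn_nonempty)
    show "A \<noteq> {}" using assms right_ideal_eq_carrier unfolding A_def by blast
    show "\<Union>C \<in> A" if "C \<noteq> {}" "subset.chain A C" for C
    proof -
      have C: "\<And>K. K \<in> C \<Longrightarrow> right_ideal K R \<and> I \<subseteq> K \<and> \<one> \<notin> K"
        and chain: "\<And>K L. \<lbrakk>K \<in> C; L \<in> C\<rbrakk> \<Longrightarrow> K \<subseteq> L \<or> L \<subseteq> K"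
        using that(2) unfolding A_def subset_chain_def by blast+
      have "right_ideal (\<Union>C) R"
        using right_ideal_Union_chain[OF that(1)] C chain by blast
      then show ?thesis using C that(1) unfolding A_def by blast
    qed
  qed
  then obtain J where "J \<in> A" and max: "\<And>K. \<lbrakk>K \<in> A; J \<subseteq> K\<rbrakk> \<Longrightarrow> K = J"
    by auto
  then have J: "right_ideal J R" "I \<subseteq> J" "\<one> \<notin> J" by (auto simp: A_def)
  have "K = J \<or> K = carrier R" if "right_ideal K R" "J \<subseteq> K" for K
  proof (cases "\<one> \<in> K")
    case True
    then show ?thesis using right_ideal_eq_carrier that(1) by simp
  next
    case False
    then show ?thesis using max[of K] that J(2) by (auto simp: A_def)
  qed
  moreover have "J \<noteq> carrier R" using J(3) by auto
  ultimately have "maximal_right_ideal J R"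
    unfolding maximal_right_ideal_def using J(1) by blast
  then show thesis using J(2) by (rule that)
qed

lemma (in ring) right_ideal_right_multiples:
  assumes "a \<in> carrier R"
  shows "right_ideal ((\<otimes>) a ` carrier R) R"
proof (rule right_idealI)
  show "\<zero> \<in> (\<otimes>) a ` carrier R"
    using assms by (metis imageI r_null zero_closed)
  show "x \<oplus> y \<in> (\<otimes>) a ` carrier R"
    if "x \<in> (\<otimes>) a ` carrier R" "y \<in> (\<otimes>) a ` carrier R" for x y
    using that assms by (auto simp: r_distr[symmetric])
  show "\<ominus> x \<in> (\<otimes>) a ` carrier R" if "x \<in> (\<otimes>) a ` carrier R" for x
    using that assms by (auto simp: r_minus[symmetric])
  show "x \<otimes> r \<in> (\<otimes>) a ` carrier R" if "x \<in> (\<otimes>) a ` carrier R" "r \<in> carrier R" for x r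
    using that assms by (auto simp: m_assoc)
qed (use assms in auto)

text \<open>The principal right ideal \<open>aR\<close> contains \<open>a\<close> and omits
  \<open>\<one>\<close>, so it extends to a maximal right ideal.\<close>

lemma (in ring) mem_maximal_right_ideal_if_not_right_invertible:
  assumes "a \<in> carrier R" "\<nexists>b. b \<in> carrier R \<and> a \<otimes> b = \<one>"
  obtains J where "maximal_right_ideal J R" "a \<in> J"
proof -
  have "a \<in> (\<otimes>) a ` carrier R" using assms(1) by (metis imageI one_closed r_one)
  moreover have "(\<otimes>) a ` carrier R \<noteq> carrier R"
    using assms(2) one_closed by (metis imageE)
  ultimately show thesis
    using ex_maximal_right_ideal[OF right_ideal_right_multiples[OF assms(1)]] that by blast
qed

section \<open>Uniqueness of the maximal right ideal in terms of right invertibility\<close>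

lemma (in ring) right_ideal_set_add:
  assumes I: "right_ideal I R" and J: "right_ideal J R"
  shows "right_ideal (I <+>\<^bsub>R\<^esub> J) R"
proof -
  have "additive_subgroup (I <+>\<^bsub>R\<^esub> J) R"
    using I J add_additive_subgroups by (simp add: right_ideal_def)
  moreover have "x \<otimes> r \<in> I <+>\<^bsub>R\<^esub> J" if "x \<in> I <+>\<^bsub>R\<^esub> J" "r \<in> carrier R" for x r
  proof -
    from that(1) obtain i j where ij: "i \<in> I" "j \<in> J" "x = i \<oplus> j"
      unfolding set_add_def' by blast
    moreover from ij have "i \<in> carrier R" "j \<in> carrier R"
      using right_idealD(1)[OF I] right_idealD(1)[OF J] by auto
    ultimately have "x \<otimes> r = i \<otimes> r \<oplus> j \<otimes> r"
      using that(2) by (simp add: l_distr)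
    moreover have "i \<otimes> r \<in> I" "j \<otimes> r \<in> J"
      using ij that(2) right_idealD(5)[OF I] right_idealD(5)[OF J] by auto
    ultimately show ?thesis unfolding set_add_def' by blast
  qed
  ultimately show ?thesis using ring_axioms by (simp add: right_ideal_def)
qed

text \<open>Forward: a unique maximal right ideal contains every element without a right inverse, so
  it would contain \<open>a + (1 - a) = 1\<close> if both summands failed. Backward:
  \<open>\<one> \<noteq> \<zero>\<close> makes the zero ideal proper, which gives existence; two
  different maximal right ideals would give \<open>1 = i + k\<close>, and a right inverse of
  \<open>i\<close> or of \<open>k = 1 - i\<close> would put \<open>\<one>\<close> into one of
  them.\<close>

lemma (in ring) local_ring_iff:
  "local_ring R \<longleftrightarrow> \<one> \<noteq> \<zero> \<and>
    (\<forall>a\<in>carrier R. (\<exists>b\<in>carrier R. a \<otimes> b = \<one>) \<or> (\<exists>b\<in>carrier R. (\<one> \<ominus> a) \<otimes> b = \<one>))"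
  (is "?L \<longleftrightarrow> _ \<and> (\<forall>a\<in>carrier R. ?inv a \<or> ?inv (\<one> \<ominus> a))")
proof (intro iffI conjI ballI)
  assume ?L
  then obtain I where I: "maximal_right_ideal I R"
    and uniq: "\<And>J. maximal_right_ideal J R \<Longrightarrow> J = I"
    unfolding local_ring_def by auto
  have ri: "right_ideal I R" and notin: "\<one> \<notin> I"
    using I right_ideal_eq_carrier by (auto simp: maximal_right_ideal_def)
  show "\<one> \<noteq> \<zero>" using notin right_idealD(2)[OF ri] by auto
  fix a assume a: "a \<in> carrier R"
  show "?inv a \<or> ?inv (\<one> \<ominus> a)"
  proof (rule ccontr)
    assume "\<not> ?thesis"
    then have "a \<in> I" "\<one> \<ominus> a \<in> I"
      using mem_maximal_right_ideal_if_not_right_invertible[of a]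
        mem_maximal_right_ideal_if_not_right_invertible[of "\<one> \<ominus> a"] uniq a
      by (metis, metis minus_closed one_closed)
    then have "a \<oplus> (\<one> \<ominus> a) \<in> I" using right_idealD(3)[OF ri] by blast
    moreover have "a \<oplus> (\<one> \<ominus> a) = \<one>" using a by algebra
    ultimately show False using notin by simp
  qed
next
  assume R: "\<one> \<noteq> \<zero> \<and> (\<forall>a\<in>carrier R. ?inv a \<or> ?inv (\<one> \<ominus> a))"
  have "right_ideal {\<zero>} R" by (rule right_idealI) auto
  moreover have "{\<zero>} \<noteq> carrier R" using R by auto
  ultimately obtain I where I: "maximal_right_ideal I R"
    using ex_maximal_right_ideal by metis
  have "K = I" if K: "maximal_right_ideal K R" for K
  proof (rule ccontr)
    assume "K \<noteq> I"
    have ri: "right_ideal I R" "right_ideal K R"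
      and notin: "\<one> \<notin> I" "\<one> \<notin> K"
      using I K right_ideal_eq_carrier by (auto simp: maximal_right_ideal_def)
    note sub = right_idealD(1)[OF ri(1)] right_idealD(1)[OF ri(2)]
    have "I \<subseteq> I <+>\<^bsub>R\<^esub> K"
    proof
      fix x assume "x \<in> I"
      moreover from this have "x = x \<oplus> \<zero>" using sub by auto
      ultimately show "x \<in> I <+>\<^bsub>R\<^esub> K"
        using right_idealD(2)[OF ri(2)] unfolding set_add_def' by blast
    qed
    moreover have "K \<subseteq> I <+>\<^bsub>R\<^esub> K"
    proof
      fix x assume "x \<in> K"
      moreover from this have "x = \<zero> \<oplus> x" using sub by auto
      ultimately show "x \<in> I <+>\<^bsub>R\<^esub> K"
        using right_idealD(2)[OF ri(1)] unfolding set_add_def' by blast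
    qed
    \<comment> \<open>If the sum were proper, maximality would make it equal to both
      \<open>I\<close> and \<open>K\<close>.\<close>
    ultimately have "I <+>\<^bsub>R\<^esub> K = carrier R"
      using I K \<open>K \<noteq> I\<close> right_ideal_set_add[OF ri] unfolding maximal_right_ideal_def by metis
    then obtain i k where ik: "i \<in> I" "k \<in> K" "\<one> = i \<oplus> k"
      unfolding set_add_def' by (smt (verit) UN_iff one_closed singletonD)
    have carr: "i \<in> carrier R" "k \<in> carrier R" using ik sub by auto
    have "\<one> \<ominus> i = k" unfolding ik(3) using carr by algebra
    then have "?inv i \<or> ?inv k" using R carr by metis
    then show False
      using ik right_idealD(5)[OF ri(1)] right_idealD(5)[OF ri(2)] notin by metis
  qed
  with I show ?L using ring_axioms unfolding local_ring_def by blast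
qed

section \<open>Regular ideals\<close>

text \<open>If \<open>d = a - aba\<close> and \<open>d = dcd\<close>, then \<open>a = a (b + (1 - ba) c (1 - ab)) a\<close>.\<close>

lemma (in ring) regular_elt_if_regular_minus:
  assumes a: "a \<in> carrier R" and b: "b \<in> carrier R"
    and "regular_elt R (a \<ominus> a \<otimes> b \<otimes> a)"
  shows "regular_elt R a"
proof -
  let ?d = "a \<ominus> a \<otimes> b \<otimes> a"
  obtain c where c: "c \<in> carrier R" "?d = ?d \<otimes> c \<otimes> ?d"
    using assms(3) unfolding regular_elt_def by blast
  let ?x = "b \<oplus> (\<one> \<ominus> b \<otimes> a) \<otimes> c \<otimes> (\<one> \<ominus> a \<otimes> b)"
  have "a = a \<otimes> b \<otimes> a \<oplus> ?d" using a b by algebra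
  also have "\<dots> = a \<otimes> b \<otimes> a \<oplus> ?d \<otimes> c \<otimes> ?d" using c(2) by simp
  also have "\<dots> = a \<otimes> ?x \<otimes> a" using a b c(1) by algebra
  finally show ?thesis
    unfolding regular_elt_def using a b c(1) by (metis a_closed m_closed minus_closed one_closed)
qed

text \<open>For \<open>x = i + j\<close> choose \<open>b\<close> with \<open>i = ibi\<close>. Modulo
  \<open>J\<close> the elements \<open>x\<close> and \<open>i\<close> agree, so
  \<open>x - xbx\<close> lies in \<open>J\<close> and is regular; then \<open>x\<close> is regular
  by \<open>regular_elt_if_regular_minus\<close>.\<close>

lemma (in ring) regular_ideal_set_add:
  assumes "regular_ideal R I" "regular_ideal R J"
  shows "regular_ideal R (I <+>\<^bsub>R\<^esub> J)"
proof -
  interpret I: ideal I R using assms(1) by (simp add: regular_ideal_def)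
  interpret J: ideal J R using assms(2) by (simp add: regular_ideal_def)
  have "regular_elt R x" if "x \<in> I <+>\<^bsub>R\<^esub> J" for x
  proof -
    from that obtain i j where ij: "i \<in> I" "j \<in> J" "x = i \<oplus> j"
      unfolding set_add_def' by blast
    then obtain b where b: "b \<in> carrier R" "i = i \<otimes> b \<otimes> i"
      using assms(1) unfolding regular_ideal_def regular_elt_def by blast
    have carr: "i \<in> carrier R" "j \<in> carrier R" using ij by auto
    \<comment> \<open>The expansion \<open>xbx = ibi + jbi + xbj\<close> isolates the part that
      \<open>b\<close> cancels; every other term has a factor \<open>j\<close>.\<close>
    have "x \<ominus> x \<otimes> b \<otimes> x = (i \<ominus> i \<otimes> b \<otimes> i) \<oplus> (j \<ominus> (x \<otimes> b \<otimes> j \<oplus> j \<otimes> (b \<otimes> i)))"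
      unfolding ij(3) using carr b(1) by algebra
    also have "i \<ominus> i \<otimes> b \<otimes> i = \<zero>" using b carr by (metis r_right_minus_eq)
    also have "\<zero> \<oplus> (j \<ominus> (x \<otimes> b \<otimes> j \<oplus> j \<otimes> (b \<otimes> i))) \<in> J"
      using ij(2) carr b(1) unfolding ij(3) a_minus_def
      by (simp add: J.I_l_closed J.I_r_closed minus_add)
    finally show ?thesis
      using regular_elt_if_regular_minus[of x b] assms(2) ij(3) carr b(1)
      unfolding regular_ideal_def by auto
  qed
  then show ?thesis
    using add_ideals[OF I.is_ideal J.is_ideal] by (simp add: regular_ideal_def)
qed

lemma (in ring) regular_ideal_zero: "regular_ideal R {\<zero>}"
  using zeroideal unfolding regular_ideal_def regular_elt_def by auto

text \<open>A plain union is already closed under addition, because summands from \<open>I\<close>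
  and \<open>J\<close> have their sum in the regular ideal \<open>I + J\<close>.\<close>

lemma (in ring) regular_ideal_Union: "regular_ideal R (\<Union>{I. regular_ideal R I})"
proof -
  have ideal: "ideal I R" if "regular_ideal R I" for I
    using that by (simp add: regular_ideal_def)
  have "ideal (\<Union>{I. regular_ideal R I}) R"
  proof (rule ideal_memI)
    show "\<Union>{I. regular_ideal R I} \<subseteq> carrier R"
      by (auto simp: regular_ideal_def regular_elt_def)
    show "\<zero> \<in> \<Union>{I. regular_ideal R I}" using regular_ideal_zero by blast
    show "x \<oplus> y \<in> \<Union>{I. regular_ideal R I}"
      if "x \<in> \<Union>{I. regular_ideal R I}" "y \<in> \<Union>{I. regular_ideal R I}" for x y
    proof -
      from that obtain I J where "regular_ideal R I" "x \<in> I" "regular_ideal R J" "y \<in> J"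
        by blast
      moreover from this have "x \<oplus> y \<in> I <+>\<^bsub>R\<^esub> J" unfolding set_add_def' by blast
      ultimately show ?thesis using regular_ideal_set_add by blast
    qed
    show "\<ominus> x \<in> \<Union>{I. regular_ideal R I}" if "x \<in> \<Union>{I. regular_ideal R I}" for x
    proof -
      from that obtain I where I: "regular_ideal R I" "x \<in> I" by blast
      interpret ideal I R using ideal I(1) by blast
      show ?thesis using I by blast
    qed
  qed (use ideal ideal.I_l_closed ideal.I_r_closed in fast)+
  then show ?thesis unfolding regular_ideal_def by blast
qed

text \<open>The \<open>GREATEST\<close> in the definition has a usable value only once a greatest
  regular ideal is exhibited; the union is one.\<close>

lemma (in ring) max_regular_ideal_eq: "max_regular_ideal R = \<Union>{I. regular_ideal R I}"
  unfolding max_regular_ideal_def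
  by (rule Greatest_equality) (use regular_ideal_Union in auto)

text \<open>Regularity of the coset says that \<open>a - aba\<close> lies in \<open>M\<close> for a
  representative \<open>b\<close>; as \<open>M\<close> consists of regular elements,
  \<open>regular_elt_if_regular_minus\<close> applies.\<close>

lemma (in ring) regular_elt_if_regular_coset:
  assumes M: "regular_ideal R M" and a: "a \<in> carrier R"
    and reg: "regular_elt (R Quot M) (M +> a)"
  shows "regular_elt R a"
proof -
  interpret ideal M R using M by (simp add: regular_ideal_def)
  interpret hom: ring_hom_ring R "R Quot M" "(+>) M" by (rule rcos_ring_hom_ring)
  obtain B where "B \<in> carrier (R Quot M)"
    "M +> a = (M +> a) \<otimes>\<^bsub>R Quot M\<^esub> B \<otimes>\<^bsub>R Quot M\<^esub> (M +> a)"
    using reg unfolding regular_elt_def by blast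
  moreover from this obtain b where "b \<in> carrier R" "B = M +> b"
    unfolding FactRing_simps by auto
  ultimately have b: "b \<in> carrier R" "M +> a = M +> (a \<otimes> b \<otimes> a)"
    using a by simp_all
  have "a \<ominus> a \<otimes> b \<otimes> a \<in> M"
    using b a by (metis a_minus_def a_rcos_module_imp a_rcos_self m_closed)
  then show ?thesis
    using M regular_elt_if_regular_minus[OF a b(1)] by (simp add: regular_ideal_def)
qed

section \<open>Abelian VNL rings\<close>

text \<open>The hypothesis makes \<open>eR\<close> a regular ideal, and \<open>e\<close> belongs to
  it.\<close>

lemma (in ring) mem_max_regular_ideal_if_central_idempotent:
  assumes "idempotent_elt R e" "central_elt R e"
    and reg: "\<And>x. x \<in> carrier R \<Longrightarrow> regular_elt R (e \<otimes> x)"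
  shows "e \<in> max_regular_ideal R"
proof -
  have e: "e \<in> carrier R" "e \<otimes> e = e" and comm: "\<And>x. x \<in> carrier R \<Longrightarrow> e \<otimes> x = x \<otimes> e"
    using assms(1,2) by (auto simp: idempotent_elt_def central_elt_def)
  \<comment> \<open>This is \<open>eR\<close>, written as the fixed points of multiplication by
    \<open>e\<close>. Closure under left multiplication is where centrality is used.\<close>
  let ?I = "{x \<in> carrier R. e \<otimes> x = x}"
  have "ideal ?I R"
  proof (rule ideal_memI)
    fix x r assume x: "x \<in> ?I" and r: "r \<in> carrier R"
    have "e \<otimes> (r \<otimes> x) = r \<otimes> (e \<otimes> x)"
      using x r e(1) comm[OF r] by (metis (lifting) m_assoc mem_Collect_eq)
    then show "r \<otimes> x \<in> ?I" using x r by auto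
    show "x \<otimes> r \<in> ?I" using x r e(1) by (auto simp: m_assoc[symmetric])
  qed (use e(1) in \<open>auto simp: r_distr r_minus\<close>)
  moreover have "regular_elt R x" if "x \<in> ?I" for x using reg[of x] that by auto
  ultimately have "regular_ideal R ?I" by (simp add: regular_ideal_def)
  then show ?thesis unfolding max_regular_ideal_eq using e by blast
qed

text \<open>If \<open>a = aba\<close>, the same \<open>b\<close> works for \<open>ea\<close>, since
  the two factors \<open>e\<close> in \<open>(ea)b(ea)\<close> can be moved together and
  merged.\<close>

lemma (in ring) regular_elt_central_idempotent_mult:
  assumes "idempotent_elt R e" "central_elt R e" "regular_elt R a"
  shows "regular_elt R (e \<otimes> a)"
proof -
  have e: "e \<in> carrier R" "e \<otimes> e = e" and comm: "\<And>x. x \<in> carrier R \<Longrightarrow> e \<otimes> x = x \<otimes> e"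
    using assms(1,2) by (auto simp: idempotent_elt_def central_elt_def)
  obtain b where ab: "a \<in> carrier R" "b \<in> carrier R" "a = a \<otimes> b \<otimes> a"
    using assms(3) unfolding regular_elt_def by blast
  have "e \<otimes> a \<otimes> b \<otimes> (e \<otimes> a) = e \<otimes> (a \<otimes> b \<otimes> e) \<otimes> a"
    using e(1) ab(1,2) by (simp add: m_assoc)
  also have "a \<otimes> b \<otimes> e = e \<otimes> (a \<otimes> b)" using comm[of "a \<otimes> b"] ab(1,2) by simp
  also have "e \<otimes> (e \<otimes> (a \<otimes> b)) \<otimes> a = (e \<otimes> e) \<otimes> (a \<otimes> b \<otimes> a)"
    using e(1) ab(1,2) by (simp add: m_assoc)
  also have "\<dots> = e \<otimes> a" using e ab(3) by simp
  finally have "e \<otimes> a = e \<otimes> a \<otimes> b \<otimes> (e \<otimes> a)" by simp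
  then show ?thesis unfolding regular_elt_def using e(1) ab(1,2) by auto
qed

lemma (in ring) idempotent_elt_one_minus:
  assumes "idempotent_elt R e"
  shows "idempotent_elt R (\<one> \<ominus> e)"
proof -
  have e: "e \<in> carrier R" "e \<otimes> e = e" using assms by (auto simp: idempotent_elt_def)
  \<comment> \<open>This identity holds for every \<open>e\<close>; idempotence enters only in the
    next step, which cancels the difference \<open>e - ee\<close>.\<close>
  have "(\<one> \<ominus> e) \<otimes> (\<one> \<ominus> e) = \<one> \<ominus> e \<ominus> (e \<ominus> e \<otimes> e)"
    using e(1) r_one[OF e(1)] by algebra
  also have "\<dots> = \<one> \<ominus> e" unfolding e(2) using e(1) by algebra
  finally show ?thesis using e(1) by (simp add: idempotent_elt_def)
qed

text \<open>Centrality splits the ring as the product of \<open>eR\<close> and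
  \<open>(1 - e)R\<close>. If neither factor is regular, a bad element of the first and one minus a
  bad element of the second combine into a counterexample to VNL.\<close>

lemma idempotent_dichotomy:
  assumes ab: "abelian_ring R" and "VNL_ring R" and idem: "idempotent_elt R e"
  shows "e \<in> max_regular_ideal R \<or> \<one>\<^bsub>R\<^esub> \<ominus>\<^bsub>R\<^esub> e \<in> max_regular_ideal R"
proof (rule ccontr)
  interpret ring R using ab by (simp add: abelian_ring_def)
  let ?f = "\<one>\<^bsub>R\<^esub> \<ominus>\<^bsub>R\<^esub> e"
  have idem': "idempotent_elt R ?f" using idempotent_elt_one_minus[OF idem] .
  have central: "central_elt R e" "central_elt R ?f"
    using ab idem idem' by (auto simp: abelian_ring_def)
  have e: "e \<in> carrier R" "e \<otimes>\<^bsub>R\<^esub> e = e" using idem by (auto simp: idempotent_elt_def)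
  assume "\<not> ?thesis"
  then obtain x y where x: "x \<in> carrier R" "\<not> regular_elt R (e \<otimes>\<^bsub>R\<^esub> x)"
    and y: "y \<in> carrier R" "\<not> regular_elt R (?f \<otimes>\<^bsub>R\<^esub> y)"
    using mem_max_regular_ideal_if_central_idempotent idem idem' central by metis
  \<comment> \<open>The component of \<open>a\<close> at \<open>e\<close> is that of
    \<open>x\<close>, and the component of \<open>1 - a\<close> at \<open>1 - e\<close> is that of
    \<open>y\<close>. Hence neither \<open>a\<close> nor \<open>1 - a\<close> can be
    regular.\<close>
  define a where "a = e \<otimes>\<^bsub>R\<^esub> x \<oplus>\<^bsub>R\<^esub> ?f \<otimes>\<^bsub>R\<^esub> (\<one>\<^bsub>R\<^esub> \<ominus>\<^bsub>R\<^esub> y)"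
  have a: "a \<in> carrier R" unfolding a_def using e(1) x(1) y(1) by simp
  \<comment> \<open>As before, the general identity keeps \<open>e - ee\<close> visible, and
    idempotence then removes it; the computation for \<open>?f\<close> follows the same
    pattern.\<close>
  have "e \<otimes>\<^bsub>R\<^esub> a = (e \<otimes>\<^bsub>R\<^esub> e) \<otimes>\<^bsub>R\<^esub> x \<oplus>\<^bsub>R\<^esub> (e \<ominus>\<^bsub>R\<^esub> e \<otimes>\<^bsub>R\<^esub> e) \<otimes>\<^bsub>R\<^esub> (\<one>\<^bsub>R\<^esub> \<ominus>\<^bsub>R\<^esub> y)"
    unfolding a_def using e(1) x(1) y(1) r_one[OF e(1)] by algebra
  also have "\<dots> = e \<otimes>\<^bsub>R\<^esub> x" unfolding e(2) using e(1) x(1) y(1) by algebra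
  finally have ea: "e \<otimes>\<^bsub>R\<^esub> a = e \<otimes>\<^bsub>R\<^esub> x" .
  have "?f \<otimes>\<^bsub>R\<^esub> (\<one>\<^bsub>R\<^esub> \<ominus>\<^bsub>R\<^esub> a) = ?f \<otimes>\<^bsub>R\<^esub> y \<ominus>\<^bsub>R\<^esub> (e \<ominus>\<^bsub>R\<^esub> e \<otimes>\<^bsub>R\<^esub> e) \<otimes>\<^bsub>R\<^esub> x
      \<oplus>\<^bsub>R\<^esub> (e \<ominus>\<^bsub>R\<^esub> e \<otimes>\<^bsub>R\<^esub> e) \<otimes>\<^bsub>R\<^esub> (\<one>\<^bsub>R\<^esub> \<ominus>\<^bsub>R\<^esub> y)"
    unfolding a_def using e(1) x(1) y(1) r_one[OF e(1)] by algebra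
  also have "\<dots> = ?f \<otimes>\<^bsub>R\<^esub> y" unfolding e(2) using e(1) x(1) y(1) by algebra
  finally have fa: "?f \<otimes>\<^bsub>R\<^esub> (\<one>\<^bsub>R\<^esub> \<ominus>\<^bsub>R\<^esub> a) = ?f \<otimes>\<^bsub>R\<^esub> y" .
  have "regular_elt R a \<or> regular_elt R (\<one>\<^bsub>R\<^esub> \<ominus>\<^bsub>R\<^esub> a)"
    using \<open>VNL_ring R\<close> a by (simp add: VNL_ring_def)
  then show False
    using regular_elt_central_idempotent_mult[OF idem central(1)]
      regular_elt_central_idempotent_mult[OF idem' central(2)] x(2) y(2) ea fa by metis
qed

text \<open>With \<open>a = aba\<close> the product \<open>ab\<close> is idempotent, so
  \<open>idempotent_dichotomy\<close> applies to it. If \<open>ab\<close> lies in the ideal, so does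
  \<open>a = (ab)a\<close>; otherwise \<open>1 - ab\<close> does.\<close>

lemma regular_elt_dichotomy:
  assumes "abelian_ring R" "VNL_ring R" "regular_elt R a"
  shows "a \<in> max_regular_ideal R \<or>
    (\<exists>b\<in>carrier R. \<one>\<^bsub>R\<^esub> \<ominus>\<^bsub>R\<^esub> a \<otimes>\<^bsub>R\<^esub> b \<in> max_regular_ideal R)"
proof -
  interpret ring R using assms(1) by (simp add: abelian_ring_def)
  interpret ideal "max_regular_ideal R" R
    using regular_ideal_Union by (simp add: max_regular_ideal_eq regular_ideal_def)
  obtain b where b: "a \<in> carrier R" "b \<in> carrier R" "a = a \<otimes>\<^bsub>R\<^esub> b \<otimes>\<^bsub>R\<^esub> a"
    using assms(3) unfolding regular_elt_def by blast
  then have "idempotent_elt R (a \<otimes>\<^bsub>R\<^esub> b)"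
    unfolding idempotent_elt_def by (metis m_assoc m_closed)
  from idempotent_dichotomy[OF assms(1,2) this] show ?thesis
    using b I_r_closed by metis
qed

section \<open>Transfer between the ring and its quotient\<close>

theorem theorem3p5:
  fixes R :: "('a, 'b) ring_scheme"
  assumes "abelian_ring R"
  shows "VNL_ring R \<longleftrightarrow>
    local_ring (R Quot max_regular_ideal R) \<or> zero_ring (R Quot max_regular_ideal R)"
proof -
  define M where "M = max_regular_ideal R"
  interpret ring R using assms by (simp add: abelian_ring_def)
  have M: "regular_ideal R M" unfolding M_def max_regular_ideal_eq by (rule regular_ideal_Union)
  interpret M: ideal M R using M by (simp add: regular_ideal_def)
  let ?S = "R Quot M" and ?h = "(+>\<^bsub>R\<^esub>) M"
  have carrier_S: "carrier ?S = ?h ` carrier R"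
    unfolding FactRing_def A_RCOSETS_def' by auto
  have zero_S: "\<zero>\<^bsub>?S\<^esub> = M" by (simp add: FactRing_def)
  interpret hom: ring_hom_ring R ?S ?h by (rule M.rcos_ring_hom_ring)
  have h_eq_zero: "?h x = \<zero>\<^bsub>?S\<^esub>" if "x \<in> M" for x
    unfolding zero_S by (rule M.a_rcos_const[OF that])
  have h_minus: "?h (x \<ominus>\<^bsub>R\<^esub> y) = ?h x \<ominus>\<^bsub>?S\<^esub> ?h y"
    if "x \<in> carrier R" "y \<in> carrier R" for x y
    unfolding a_minus_def
    using that hom.hom_add[of x "\<ominus>\<^bsub>R\<^esub> y"] hom.hom_a_inv[of y] a_inv_closed[of y] by metis
  have h_one_minus: "?h (\<one>\<^bsub>R\<^esub> \<ominus>\<^bsub>R\<^esub> x) = \<one>\<^bsub>?S\<^esub> \<ominus>\<^bsub>?S\<^esub> ?h x" if "x \<in> carrier R" for x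
    using h_minus[OF one_closed that] hom.hom_one by metis
  have "zero_ring ?S \<longleftrightarrow> \<one>\<^bsub>?S\<^esub> = \<zero>\<^bsub>?S\<^esub>"
    unfolding zero_ring_def
    using hom.S.ring_axioms hom.S.carrier_one_zero by simp
  \<comment> \<open>The zero quotient supplies the case \<open>1 = 0\<close> that
    \<open>local_ring_iff\<close> excludes; there every element is right invertible, as
    \<open>A0 = 0 = 1\<close>.\<close>
  then have "local_ring ?S \<or> zero_ring ?S \<longleftrightarrow>
      (\<forall>A\<in>carrier ?S. (\<exists>B\<in>carrier ?S. A \<otimes>\<^bsub>?S\<^esub> B = \<one>\<^bsub>?S\<^esub>) \<or>
        (\<exists>B\<in>carrier ?S. (\<one>\<^bsub>?S\<^esub> \<ominus>\<^bsub>?S\<^esub> A) \<otimes>\<^bsub>?S\<^esub> B = \<one>\<^bsub>?S\<^esub>))"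
    (is "_ \<longleftrightarrow> (\<forall>A\<in>_. ?inv A \<or> ?inv (_ \<ominus>\<^bsub>?S\<^esub> A))")
    using hom.S.local_ring_iff hom.S.r_null hom.S.zero_closed by metis
  also have "\<dots> \<longleftrightarrow> VNL_ring R"
  proof
    assume inv: "\<forall>A\<in>carrier ?S. ?inv A \<or> ?inv (\<one>\<^bsub>?S\<^esub> \<ominus>\<^bsub>?S\<^esub> A)"
    have reg: "regular_elt R a" if a: "a \<in> carrier R" and "?inv (?h a)" for a
    proof -
      \<comment> \<open>A right inverse \<open>B\<close> of \<open>A\<close> already gives
        \<open>ABA = A\<close>.\<close>
      have "regular_elt ?S (?h a)"
        unfolding regular_elt_def using that by (metis hom.S.l_one hom.hom_closed)
      then show ?thesis by (rule regular_elt_if_regular_coset[OF M a])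
    qed
    have "regular_elt R a \<or> regular_elt R (\<one>\<^bsub>R\<^esub> \<ominus>\<^bsub>R\<^esub> a)" if "a \<in> carrier R" for a
      using that inv reg h_one_minus by (metis hom.hom_closed minus_closed one_closed)
    then show "VNL_ring R" using ring_axioms by (simp add: VNL_ring_def)
  next
    assume vnl: "VNL_ring R"
    have zero_or_inv: "?h a = \<zero>\<^bsub>?S\<^esub> \<or> ?inv (?h a)" if reg: "regular_elt R a" for a
    proof -
      have a: "a \<in> carrier R" using reg by (simp add: regular_elt_def)
      consider "a \<in> M" | b where "b \<in> carrier R" "\<one>\<^bsub>R\<^esub> \<ominus>\<^bsub>R\<^esub> a \<otimes>\<^bsub>R\<^esub> b \<in> M"
        using regular_elt_dichotomy[OF assms vnl reg] unfolding M_def by blast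
      then show ?thesis
      proof cases
        case 1
        then show ?thesis using h_eq_zero by blast
      next
        case 2
        then have "\<one>\<^bsub>?S\<^esub> \<ominus>\<^bsub>?S\<^esub> ?h a \<otimes>\<^bsub>?S\<^esub> ?h b = \<zero>\<^bsub>?S\<^esub>"
          using a h_eq_zero[OF 2(2)] h_one_minus[of "a \<otimes>\<^bsub>R\<^esub> b"] by simp
        then have "?h a \<otimes>\<^bsub>?S\<^esub> ?h b = \<one>\<^bsub>?S\<^esub>"
          using a 2(1) by (metis hom.S.m_closed hom.S.one_closed hom.S.r_right_minus_eq hom.hom_closed)
        then show ?thesis using 2(1) hom.hom_closed by blast
      qed
    qed
    have inv_one: "?inv \<one>\<^bsub>?S\<^esub>" by (metis hom.S.l_one hom.S.one_closed)
    show "\<forall>A\<in>carrier ?S. ?inv A \<or> ?inv (\<one>\<^bsub>?S\<^esub> \<ominus>\<^bsub>?S\<^esub> A)"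
    proof
      fix A assume A: "A \<in> carrier ?S"
      then obtain a where a: "a \<in> carrier R" "A = ?h a" using carrier_S by blast
      \<comment> \<open>VNL makes \<open>a\<close> or \<open>1 - a\<close> regular, and
        \<open>zero_or_inv\<close> applies to that one. In the two vanishing cases the complementary
        element is \<open>1\<close>, which is right invertible.\<close>
      have "A = \<zero>\<^bsub>?S\<^esub> \<or> ?inv A \<or> \<one>\<^bsub>?S\<^esub> \<ominus>\<^bsub>?S\<^esub> A = \<zero>\<^bsub>?S\<^esub> \<or> ?inv (\<one>\<^bsub>?S\<^esub> \<ominus>\<^bsub>?S\<^esub> A)"
        using zero_or_inv vnl a h_one_minus unfolding VNL_ring_def by metis
      moreover have "\<one>\<^bsub>?S\<^esub> \<ominus>\<^bsub>?S\<^esub> \<zero>\<^bsub>?S\<^esub> = \<one>\<^bsub>?S\<^esub>" by (simp add: a_minus_def)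
      moreover have "A = \<one>\<^bsub>?S\<^esub>" if "\<one>\<^bsub>?S\<^esub> \<ominus>\<^bsub>?S\<^esub> A = \<zero>\<^bsub>?S\<^esub>"
        using that A by (metis hom.S.one_closed hom.S.r_right_minus_eq)
      ultimately show "?inv A \<or> ?inv (\<one>\<^bsub>?S\<^esub> \<ominus>\<^bsub>?S\<^esub> A)" using inv_one by auto
    qed
  qed
  finally show ?thesis unfolding M_def by blast
qed

end
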